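(* If $G$ and $H$ are arbitrary graphs, then $$\max\{\chi_{2}^{f}(G),\chi_{2}^{f}(H)\}\le \chi_{2}^{f}(G\,\square\, H)\le \max\{\chi_2(G),\chi_2(H)\},$$ and the bounds are sharp, i.e., each of the two inequalities is attained with equality for some $G$ and $H$.
   Context: All graphs are finite and simple, with nonempty vertex set. The Cartesian product $G\,\square\, H$ has vertex set $V(G)\times V(H)$, two vertices being adjacent if they are adjacent in one coordinate and equal in the other. A $2$-frugal coloring of a graph is a proper vertex coloring in which no color appears more than twice in the (open) neighborhood of any vertex; $\chi_2^f(G)$ is the minimum number of colors in a $2$-frugal coloring of $G$. A $2$-distance coloring of $G$ is a vertex coloring in which any two distinct vertices at distance at most $2$ receive different colors; $\chi_2(G)$ is the minimum number of colors in a $2$-distance coloring of $G$. *)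

theory Defs
  imports "Graph_Theory.Pair_Digraph" "Graph_Theory.Shortest_Path"
begin

text \<open>
  A finite simple graph is a \<^locale>\<open>pair_graph\<close>: a finite, loopfree digraph without parallel
  arcs whose arc relation is symmetric, so an edge \<open>uv\<close> is the pair of arcs \<open>(u,v)\<close>, \<open>(v,u)\<close>.
  The locale admits the empty vertex set, which is excluded here.
\<close>

definition simple_graph :: "'a pair_pre_digraph \<Rightarrow> bool" where
  "simple_graph G \<longleftrightarrow> pair_graph G \<and> pverts G \<noteq> {}"

definition cartesian_product ::
    "'a pair_pre_digraph \<Rightarrow> 'b pair_pre_digraph \<Rightarrow> ('a \<times> 'b) pair_pre_digraph" (infixl "\<box>" 70) where
  "G \<box> H = \<lparr> pverts = pverts G \<times> pverts H,
     parcs = {((g, h), (g', h')).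
       g \<in> pverts G \<and> g' \<in> pverts G \<and> h \<in> pverts H \<and> h' \<in> pverts H \<and>
       ((g, g') \<in> parcs G \<and> h = h' \<or> g = g' \<and> (h, h') \<in> parcs H)} \<rparr>"

lemma simple_graph_cartesian_product:
  assumes "simple_graph G" "simple_graph H"
  shows "simple_graph (G \<box> H)"
proof -
  interpret G: pair_graph G using assms(1) by (simp add: simple_graph_def)
  interpret H: pair_graph H using assms(2) by (simp add: simple_graph_def)
  have sub: "parcs (G \<box> H) \<subseteq> (pverts G \<times> pverts H) \<times> (pverts G \<times> pverts H)"
    by (auto simp: cartesian_product_def)
  have fin: "finite (parcs (G \<box> H))"
    by (rule finite_subset[OF sub]) (simp add: G.pair_finite_verts H.pair_finite_verts)
  have symG: "sym (parcs G)" and symH: "sym (parcs H)"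
    using G.pair_sym_arcs H.pair_sym_arcs by (simp_all add: symmetric_def)
  have "symmetric (with_proj (G \<box> H))"
    using symG symH by (auto simp: symmetric_def cartesian_product_def sym_def)
  moreover have "\<And>e. e \<in> parcs (G \<box> H) \<Longrightarrow> fst e \<noteq> snd e"
    using G.pair_no_loops H.pair_no_loops by (fastforce simp: cartesian_product_def)
  ultimately have "pair_graph (G \<box> H)"
    using fin sub by unfold_locales
      (auto simp: cartesian_product_def G.pair_finite_verts H.pair_finite_verts)
  with assms show ?thesis by (auto simp: simple_graph_def cartesian_product_def)
qed

definition open_nbhd :: "'a pair_pre_digraph \<Rightarrow> 'a \<Rightarrow> 'a set" where
  "open_nbhd G v = {u \<in> pverts G. (v, u) \<in> parcs G}"

definition proper_coloring :: "'a pair_pre_digraph \<Rightarrow> ('a \<Rightarrow> nat) \<Rightarrow> bool" where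
  "proper_coloring G c \<longleftrightarrow> (\<forall>(u, v) \<in> parcs G. c u \<noteq> c v)"

definition two_frugal_coloring :: "'a pair_pre_digraph \<Rightarrow> ('a \<Rightarrow> nat) \<Rightarrow> bool" where
  "two_frugal_coloring G c \<longleftrightarrow> proper_coloring G c \<and>
     (\<forall>v \<in> pverts G. \<forall>i. card {u \<in> open_nbhd G v. c u = i} \<le> 2)"

text \<open>
  The least cost of a walk under unit arc weights; it is \<open>\<infinity>\<close> if no walk joins the two vertices.
\<close>

definition graph_dist :: "'a pair_pre_digraph \<Rightarrow> 'a \<Rightarrow> 'a \<Rightarrow> ereal" where
  "graph_dist G u v = wf_digraph.\<mu> (with_proj G) (\<lambda>_. 1) u v"

definition two_distance_coloring :: "'a pair_pre_digraph \<Rightarrow> ('a \<Rightarrow> nat) \<Rightarrow> bool" where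
  "two_distance_coloring G c \<longleftrightarrow>
     (\<forall>u \<in> pverts G. \<forall>v \<in> pverts G. u \<noteq> v \<and> graph_dist G u v \<le> 2 \<longrightarrow> c u \<noteq> c v)"

text \<open>
  Colorings are total functions whose values off the vertex set are irrelevant, so the number of
  colors used is the cardinality of the image of the vertex set.
\<close>

definition frugal_chromatic_number :: "'a pair_pre_digraph \<Rightarrow> nat" ("\<chi>\<^sub>2\<^sup>f") where
  "\<chi>\<^sub>2\<^sup>f G = (LEAST k. \<exists>c. two_frugal_coloring G c \<and> card (c ` pverts G) = k)"

definition two_distance_chromatic_number :: "'a pair_pre_digraph \<Rightarrow> nat" ("\<chi>\<^sub>2") where
  "\<chi>\<^sub>2 G = (LEAST k. \<exists>c. two_distance_coloring G c \<and> card (c ` pverts G) = k)"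

end

theory Submission
  imports Defs
begin

text \<open>
  The lower bound is monotonicity of \<open>\<chi>\<^sub>2\<^sup>f\<close> under taking subgraphs: restricting a frugal coloring
  shrinks neighborhoods and cannot add colors, and each factor embeds in the product as a fiber
  (lemma \<open>frugal_chromatic_number_mono\<close>).

  For the upper bound, color both factors by 2-distance colorings \<open>c\<close> and \<open>d\<close> with values in the
  cyclic group of order \<open>k = max (\<chi>\<^sub>2 G) (\<chi>\<^sub>2 H)\<close> and give \<open>(g, h)\<close> the color \<open>c g + d h\<close>. The
  neighborhood of \<open>(g, h)\<close> is the union of a part in the \<open>G\<close>-fiber and a part in the \<open>H\<close>-fiber. On
  each of them the sum is a translate of a 2-distance coloring, hence injective there, so every
  color occurs at most once in each part and at most twice altogether
  (lemma \<open>two_frugal_coloring_sum\<close>).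

  Both bounds are attained as soon as \<open>\<chi>\<^sub>2\<^sup>f\<close> and \<open>\<chi>\<^sub>2\<close> agree on a graph \<open>G\<close>, by taking
  \<open>H = G\<close>: the outer terms of the inequality then coincide. Complete graphs have this property.
\<close>

section \<open>Colorings and the two chromatic numbers\<close>

lemma frugal_chromatic_number_le:
  assumes "two_frugal_coloring G c"
  shows "\<chi>\<^sub>2\<^sup>f G \<le> card (c ` pverts G)"
  unfolding frugal_chromatic_number_def using assms by (blast intro: Least_le)

lemma two_distance_chromatic_number_le:
  assumes "two_distance_coloring G c"
  shows "\<chi>\<^sub>2 G \<le> card (c ` pverts G)"
  unfolding two_distance_chromatic_number_def using assms by (blast intro: Least_le)

lemma two_distance_coloring_if_inj_on:
  assumes "inj_on c (pverts G)"
  shows "two_distance_coloring G c"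
  using assms by (auto simp: two_distance_coloring_def inj_on_def)

lemma two_frugal_coloring_if_inj_on:
  assumes "simple_graph G" and inj: "inj_on c (pverts G)"
  shows "two_frugal_coloring G c"
proof -
  interpret pair_graph G using assms(1) by (simp add: simple_graph_def)
  have "proper_coloring G c"
    unfolding proper_coloring_def
  proof clarify
    fix u v assume arc: "(u, v) \<in> parcs G" and "c u = c v"
    then show False
      using inj_onD[OF inj] in_arcsD1[OF arc] in_arcsD2[OF arc] pair_no_loops[OF arc] by auto
  qed
  moreover have "card {u \<in> open_nbhd G v. c u = i} \<le> 2" for v i
  proof -
    have "finite {u \<in> open_nbhd G v. c u = i}"
      by (simp add: open_nbhd_def pair_finite_verts)
    then have "card {u \<in> open_nbhd G v. c u = i} \<le> Suc 0"
      using inj by (auto simp: card_le_Suc0_iff_eq open_nbhd_def inj_on_def)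
    then show ?thesis by simp
  qed
  ultimately show ?thesis by (simp add: two_frugal_coloring_def)
qed

lemma ex_inj_on_pverts:
  assumes "simple_graph G"
  obtains c :: "'a \<Rightarrow> nat" where "inj_on c (pverts G)"
proof -
  interpret pair_graph G using assms by (simp add: simple_graph_def)
  show ?thesis using that finite_imp_inj_to_nat_seg[OF pair_finite_verts] by blast
qed

lemma frugal_chromatic_number_attained:
  assumes "simple_graph G"
  obtains c where "two_frugal_coloring G c" "card (c ` pverts G) = \<chi>\<^sub>2\<^sup>f G"
proof -
  obtain c0 where "two_frugal_coloring G c0"
    using ex_inj_on_pverts[OF assms] two_frugal_coloring_if_inj_on[OF assms] by metis
  then have "\<exists>k c. two_frugal_coloring G c \<and> card (c ` pverts G) = k" by blast
  from LeastI_ex[OF this] show ?thesis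
    using that by (auto simp: frugal_chromatic_number_def)
qed

lemma two_distance_chromatic_number_attained:
  assumes "simple_graph G"
  obtains c where "two_distance_coloring G c" "card (c ` pverts G) = \<chi>\<^sub>2 G"
proof -
  obtain c0 where "two_distance_coloring G c0"
    using ex_inj_on_pverts[OF assms] two_distance_coloring_if_inj_on by metis
  then have "\<exists>k c. two_distance_coloring G c \<and> card (c ` pverts G) = k" by blast
  from LeastI_ex[OF this] show ?thesis
    using that by (auto simp: two_distance_chromatic_number_def)
qed

text \<open>
  Only the partition into color classes matters, so an optimal coloring may be renamed to use an
  initial segment of the natural numbers. This makes the colors available for modular arithmetic.
\<close>

lemma two_distance_coloring_bounded:
  assumes G: "simple_graph G" and "\<chi>\<^sub>2 G \<le> k"
  obtains c where "two_distance_coloring G c" "\<And>v. v \<in> pverts G \<Longrightarrow> c v < k"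
proof -
  interpret pair_graph G using G by (simp add: simple_graph_def)
  obtain c where c: "two_distance_coloring G c" and card: "card (c ` pverts G) = \<chi>\<^sub>2 G"
    using two_distance_chromatic_number_attained[OF G] .
  obtain f where f: "bij_betw f (c ` pverts G) {0..<\<chi>\<^sub>2 G}"
    using ex_bij_betw_finite_nat[of "c ` pverts G"] card pair_finite_verts by auto
  have inj: "inj_on f (c ` pverts G)" using f by (rule bij_betw_imp_inj_on)
  have "two_distance_coloring G (f \<circ> c)"
    using c by (auto simp: two_distance_coloring_def inj_on_eq_iff[OF inj])
  moreover have "(f \<circ> c) v < k" if "v \<in> pverts G" for v
  proof -
    have "f (c v) \<in> {0..<\<chi>\<^sub>2 G}" using that f by (auto simp: bij_betw_def)
    with assms(2) show ?thesis by simp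
  qed
  ultimately show ?thesis by (rule that)
qed

section \<open>What a 2-distance coloring separates\<close>

lemma two_distance_coloring_adjacent:
  assumes G: "simple_graph G" and c: "two_distance_coloring G c" and arc: "(u, v) \<in> parcs G"
  shows "c u \<noteq> c v"
proof -
  interpret pair_graph G using G by (simp add: simple_graph_def)
  have mem: "u \<in> pverts G" "v \<in> pverts G" and neq: "u \<noteq> v"
    using in_arcsD1[OF arc] in_arcsD2[OF arc] pair_no_loops[OF arc] by auto
  have "awalk u [(u, v)] v"
    using arc mem by (simp add: awalk_simps)
  then have "graph_dist G u v \<le> awalk_cost (\<lambda>_. 1) [(u, v)]"
    unfolding graph_dist_def by (rule min_cost_le_walk_cost)
  also have "\<dots> \<le> 2" by (simp add: awalk_cost_def)
  finally show ?thesis using c mem neq by (auto simp: two_distance_coloring_def)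
qed

lemma two_distance_coloring_common_neighbor:
  assumes G: "simple_graph G" and c: "two_distance_coloring G c"
    and arcs: "(v, u) \<in> parcs G" "(v, w) \<in> parcs G" and eq: "c u = c w"
  shows "u = w"
proof (rule ccontr)
  assume neq: "u \<noteq> w"
  interpret pair_graph G using G by (simp add: simple_graph_def)
  have arc': "(u, v) \<in> parcs G"
    using arcs(1) pair_sym_arcs by (auto simp: symmetric_def sym_def)
  have mem: "u \<in> pverts G" "v \<in> pverts G" "w \<in> pverts G"
    using in_arcsD1[OF arcs(1)] in_arcsD2[OF arcs(1)] in_arcsD2[OF arcs(2)] by auto
  have "awalk u [(u, v), (v, w)] w"
    using arc' arcs(2) mem by (simp add: awalk_simps)
  then have "graph_dist G u w \<le> awalk_cost (\<lambda>_. 1) [(u, v), (v, w)]"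
    unfolding graph_dist_def by (rule min_cost_le_walk_cost)
  also have "\<dots> \<le> 2" by (simp add: awalk_cost_def)
  finally show False using c mem neq eq by (auto simp: two_distance_coloring_def)
qed

section \<open>The lower bound\<close>

text \<open>
  A frugal coloring of \<open>K\<close> pulls back along the embedding \<open>f\<close>: the neighbors of \<open>v\<close> with a given
  color are mapped injectively to neighbors of \<open>f v\<close> with that color, so their number does not grow.
\<close>

lemma frugal_chromatic_number_mono:
  assumes K: "simple_graph K"
    and inj: "inj_on f (pverts G)" and verts: "f ` pverts G \<subseteq> pverts K"
    and arcs: "\<And>u v. (u, v) \<in> parcs G \<Longrightarrow> (f u, f v) \<in> parcs K"
  shows "\<chi>\<^sub>2\<^sup>f G \<le> \<chi>\<^sub>2\<^sup>f K"
proof -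
  interpret K: pair_graph K using K by (simp add: simple_graph_def)
  obtain c where c: "two_frugal_coloring K c" and card: "card (c ` pverts K) = \<chi>\<^sub>2\<^sup>f K"
    using frugal_chromatic_number_attained[OF K] .
  have "proper_coloring G (c \<circ> f)"
    using c arcs by (fastforce simp: two_frugal_coloring_def proper_coloring_def)
  moreover have "card {u \<in> open_nbhd G v. (c \<circ> f) u = i} \<le> 2" if v: "v \<in> pverts G" for v i
  proof -
    have "card {u \<in> open_nbhd G v. (c \<circ> f) u = i} \<le> card {w \<in> open_nbhd K (f v). c w = i}"
    proof (rule card_inj_on_le)
      show "inj_on f {u \<in> open_nbhd G v. (c \<circ> f) u = i}"
        by (rule inj_on_subset[OF inj]) (auto simp: open_nbhd_def)
      show "f ` {u \<in> open_nbhd G v. (c \<circ> f) u = i} \<subseteq> {w \<in> open_nbhd K (f v). c w = i}"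
        using verts arcs by (auto simp: open_nbhd_def)
      show "finite {w \<in> open_nbhd K (f v). c w = i}"
        by (simp add: open_nbhd_def K.pair_finite_verts)
    qed
    also have "\<dots> \<le> 2"
      using c v verts by (auto simp: two_frugal_coloring_def)
    finally show ?thesis .
  qed
  ultimately have "two_frugal_coloring G (c \<circ> f)"
    by (simp add: two_frugal_coloring_def)
  then have "\<chi>\<^sub>2\<^sup>f G \<le> card ((c \<circ> f) ` pverts G)"
    by (rule frugal_chromatic_number_le)
  also have "\<dots> \<le> card (c ` pverts K)"
    using verts by (intro card_mono) (auto simp: K.pair_finite_verts)
  finally show ?thesis using card by simp
qed

lemma max_frugal_chromatic_number_le_product:
  assumes G: "simple_graph G" and H: "simple_graph H"
  shows "max (\<chi>\<^sub>2\<^sup>f G) (\<chi>\<^sub>2\<^sup>f H) \<le> \<chi>\<^sub>2\<^sup>f (G \<box> H)"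
proof -
  interpret G: pair_graph G using G by (simp add: simple_graph_def)
  interpret H: pair_graph H using H by (simp add: simple_graph_def)
  obtain g h where gh: "g \<in> pverts G" "h \<in> pverts H"
    using G H by (auto simp: simple_graph_def)
  note GH = simple_graph_cartesian_product[OF G H]
  have "\<chi>\<^sub>2\<^sup>f G \<le> \<chi>\<^sub>2\<^sup>f (G \<box> H)"
    by (rule frugal_chromatic_number_mono[OF GH, where f = "\<lambda>x. (x, h)"])
      (use gh G.in_arcsD1 G.in_arcsD2 in \<open>auto simp: cartesian_product_def inj_on_def\<close>)
  moreover have "\<chi>\<^sub>2\<^sup>f H \<le> \<chi>\<^sub>2\<^sup>f (G \<box> H)"
    by (rule frugal_chromatic_number_mono[OF GH, where f = "\<lambda>y. (g, y)"])
      (use gh H.in_arcsD1 H.in_arcsD2 in \<open>auto simp: cartesian_product_def inj_on_def\<close>)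
  ultimately show ?thesis by simp
qed

section \<open>The upper bound\<close>

lemma add_mod_right_cancel:
  fixes a b x k :: nat
  assumes "(a + x) mod k = (b + x) mod k" "a < k" "b < k"
  shows "a = b"
  using assms
proof (induction a b rule: linorder_wlog)
  case (le a b)
  then have "k dvd (b + x) - (a + x)"
    using mod_eq_dvd_iff_nat[of "a + x" "b + x" k] by simp
  then have "k dvd b - a" by simp
  with le show ?case using dvd_imp_le[of k "b - a"] by fastforce
next
  case (sym a b)
  then show ?case by simp
qed

text \<open>
  The colors form the cyclic group of order \<open>k\<close>. Cancellation there turns an equality of sums along
  a fiber into an equality of colors in one factor, where two adjacent vertices, or two neighbors of
  the same vertex, are told apart.
\<close>

lemma two_frugal_coloring_sum:
  assumes G: "simple_graph G" and H: "simple_graph H"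
    and c: "two_distance_coloring G c" and c_less: "\<And>g. g \<in> pverts G \<Longrightarrow> c g < k"
    and d: "two_distance_coloring H d" and d_less: "\<And>h. h \<in> pverts H \<Longrightarrow> d h < k"
  shows "two_frugal_coloring (G \<box> H) (\<lambda>(g, h). (c g + d h) mod k)"
proof -
  interpret G: pair_graph G using G by (simp add: simple_graph_def)
  interpret H: pair_graph H using H by (simp add: simple_graph_def)
  have cancel_c: "c g = c g'"
    if "(c g + y) mod k = (c g' + y) mod k" "g \<in> pverts G" "g' \<in> pverts G" for g g' y
    using add_mod_right_cancel[OF that(1)] that c_less by blast
  have cancel_d: "d h = d h'"
    if "(x + d h) mod k = (x + d h') mod k" "h \<in> pverts H" "h' \<in> pverts H" for h h' x
    using add_mod_right_cancel[of "d h" x k "d h'"] that d_less by (simp add: add.commute)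
  have "proper_coloring (G \<box> H) (\<lambda>(g, h). (c g + d h) mod k)"
    using cancel_c cancel_d two_distance_coloring_adjacent[OF G c]
      two_distance_coloring_adjacent[OF H d]
    by (fastforce simp: proper_coloring_def cartesian_product_def)
  moreover have
    "card {u \<in> open_nbhd (G \<box> H) (g, h). (\<lambda>(g, h). (c g + d h) mod k) u = i} \<le> 2" for g h i
  proof -
    let ?A = "{g' \<in> pverts G. (g, g') \<in> parcs G \<and> (c g' + d h) mod k = i}"
    let ?B = "{h' \<in> pverts H. (h, h') \<in> parcs H \<and> (c g + d h') mod k = i}"
    have fin: "finite ?A" "finite ?B"
      by (simp_all add: G.pair_finite_verts H.pair_finite_verts)
    have "card ?A \<le> Suc 0"
      unfolding card_le_Suc0_iff_eq[OF fin(1)]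
      using cancel_c two_distance_coloring_common_neighbor[OF G c] by fastforce
    moreover have "card ?B \<le> Suc 0"
      unfolding card_le_Suc0_iff_eq[OF fin(2)]
      using cancel_d two_distance_coloring_common_neighbor[OF H d] by fastforce
    moreover have "card ((\<lambda>g'. (g', h)) ` ?A) \<le> card ?A" "card (Pair g ` ?B) \<le> card ?B"
      using fin by (auto intro: card_image_le)
    moreover have "card {u \<in> open_nbhd (G \<box> H) (g, h). (\<lambda>(g, h). (c g + d h) mod k) u = i}
        \<le> card ((\<lambda>g'. (g', h)) ` ?A \<union> Pair g ` ?B)"
      using fin by (intro card_mono) (auto simp: open_nbhd_def cartesian_product_def)
    ultimately show ?thesis
      using card_Un_le[of "(\<lambda>g'. (g', h)) ` ?A" "Pair g ` ?B"] by linarith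
  qed
  ultimately show ?thesis by (auto simp: two_frugal_coloring_def)
qed

lemma product_le_max_two_distance_chromatic_number:
  assumes G: "simple_graph G" and H: "simple_graph H"
  shows "\<chi>\<^sub>2\<^sup>f (G \<box> H) \<le> max (\<chi>\<^sub>2 G) (\<chi>\<^sub>2 H)"
proof -
  let ?k = "max (\<chi>\<^sub>2 G) (\<chi>\<^sub>2 H)"
  obtain c where c: "two_distance_coloring G c" "\<And>g. g \<in> pverts G \<Longrightarrow> c g < ?k"
    by (rule two_distance_coloring_bounded[OF G, of ?k]) auto
  obtain d where d: "two_distance_coloring H d" "\<And>h. h \<in> pverts H \<Longrightarrow> d h < ?k"
    by (rule two_distance_coloring_bounded[OF H, of ?k]) auto
  let ?e = "\<lambda>(g, h). (c g + d h) mod ?k"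
  obtain g where "g \<in> pverts G" using G by (auto simp: simple_graph_def)
  then have "0 < ?k" using c(2)[of g] by linarith
  then have "?e ` pverts (G \<box> H) \<subseteq> {..<?k}"
    by (auto simp del: max_less_iff_conj less_max_iff_disj)
  then have "card (?e ` pverts (G \<box> H)) \<le> ?k"
    using card_mono[of "{..<?k}" "?e ` pverts (G \<box> H)"] by simp
  then show ?thesis
    using frugal_chromatic_number_le[OF two_frugal_coloring_sum[OF G H c d]] by linarith
qed

section \<open>Sharpness\<close>

definition complete_graph :: "nat \<Rightarrow> nat pair_pre_digraph" where
  "complete_graph n = \<lparr> pverts = {..<n}, parcs = {(u, v). u < n \<and> v < n \<and> u \<noteq> v} \<rparr>"

lemma simple_graph_complete_graph:
  assumes "0 < n"
  shows "simple_graph (complete_graph n)"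
proof -
  have "finite (parcs (complete_graph n))"
    by (rule finite_subset[of _ "{..<n} \<times> {..<n}"]) (auto simp: complete_graph_def)
  then have "pair_graph (complete_graph n)"
    by unfold_locales (auto simp: complete_graph_def symmetric_def sym_def)
  with assms show ?thesis by (auto simp: simple_graph_def complete_graph_def)
qed

text \<open>
  All vertices of a complete graph are pairwise adjacent, so properness alone forces \<open>n\<close> colors,
  while \<open>n\<close> distinct colors satisfy every requirement on distances.
\<close>

lemma two_distance_le_frugal_complete_graph:
  assumes "0 < n"
  shows "\<chi>\<^sub>2 (complete_graph n) \<le> \<chi>\<^sub>2\<^sup>f (complete_graph n)"
proof -
  let ?K = "complete_graph n"
  obtain c where c: "two_frugal_coloring ?K c" and card: "card (c ` pverts ?K) = \<chi>\<^sub>2\<^sup>f ?K"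
    using frugal_chromatic_number_attained[OF simple_graph_complete_graph[OF assms]] .
  have "inj_on c (pverts ?K)"
    using c by (fastforce simp: two_frugal_coloring_def proper_coloring_def complete_graph_def
        inj_on_def)
  then have "\<chi>\<^sub>2 ?K \<le> card (c ` pverts ?K)"
    by (intro two_distance_chromatic_number_le two_distance_coloring_if_inj_on)
  with card show ?thesis by simp
qed

lemma complete_graph_bounds_attained:
  assumes "0 < n"
  shows "max (\<chi>\<^sub>2\<^sup>f (complete_graph n)) (\<chi>\<^sub>2\<^sup>f (complete_graph n))
      = \<chi>\<^sub>2\<^sup>f (complete_graph n \<box> complete_graph n)"
    and "\<chi>\<^sub>2\<^sup>f (complete_graph n \<box> complete_graph n)
      = max (\<chi>\<^sub>2 (complete_graph n)) (\<chi>\<^sub>2 (complete_graph n))"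
  using max_frugal_chromatic_number_le_product[of "complete_graph n" "complete_graph n"]
    product_le_max_two_distance_chromatic_number[of "complete_graph n" "complete_graph n"]
    simple_graph_complete_graph[OF assms] two_distance_le_frugal_complete_graph[OF assms]
  by simp_all

section \<open>The bounds for the Cartesian product\<close>

theorem theorem6p3:
  shows "(\<forall>(G :: 'a pair_pre_digraph) (H :: 'b pair_pre_digraph).
            simple_graph G \<and> simple_graph H \<longrightarrow>
              max (\<chi>\<^sub>2\<^sup>f G) (\<chi>\<^sub>2\<^sup>f H) \<le> \<chi>\<^sub>2\<^sup>f (G \<box> H) \<and>
              \<chi>\<^sub>2\<^sup>f (G \<box> H) \<le> max (\<chi>\<^sub>2 G) (\<chi>\<^sub>2 H)) \<and>
         (\<exists>(G :: nat pair_pre_digraph) (H :: nat pair_pre_digraph).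
            simple_graph G \<and> simple_graph H \<and>
              max (\<chi>\<^sub>2\<^sup>f G) (\<chi>\<^sub>2\<^sup>f H) = \<chi>\<^sub>2\<^sup>f (G \<box> H)) \<and>
         (\<exists>(G :: nat pair_pre_digraph) (H :: nat pair_pre_digraph).
            simple_graph G \<and> simple_graph H \<and>
              \<chi>\<^sub>2\<^sup>f (G \<box> H) = max (\<chi>\<^sub>2 G) (\<chi>\<^sub>2 H))"
proof (intro conjI allI impI)
  fix G :: "'a pair_pre_digraph" and H :: "'b pair_pre_digraph"
  assume "simple_graph G \<and> simple_graph H"
  then have G: "simple_graph G" and H: "simple_graph H" by simp_all
  show "max (\<chi>\<^sub>2\<^sup>f G) (\<chi>\<^sub>2\<^sup>f H) \<le> \<chi>\<^sub>2\<^sup>f (G \<box> H)"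
    by (rule max_frugal_chromatic_number_le_product[OF G H])
  show "\<chi>\<^sub>2\<^sup>f (G \<box> H) \<le> max (\<chi>\<^sub>2 G) (\<chi>\<^sub>2 H)"
    by (rule product_le_max_two_distance_chromatic_number[OF G H])
next
  \<comment> \<open>Two vertices give the smallest example with an edge: the product is the 4-cycle.\<close>
  have K: "simple_graph (complete_graph 2)"
    by (rule simple_graph_complete_graph) simp
  show "\<exists>(G :: nat pair_pre_digraph) (H :: nat pair_pre_digraph).
      simple_graph G \<and> simple_graph H \<and> max (\<chi>\<^sub>2\<^sup>f G) (\<chi>\<^sub>2\<^sup>f H) = \<chi>\<^sub>2\<^sup>f (G \<box> H)"
    using K complete_graph_bounds_attained(1)[OF zero_less_numeral] by blast
  show "\<exists>(G :: nat pair_pre_digraph) (H :: nat pair_pre_digraph).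
      simple_graph G \<and> simple_graph H \<and> \<chi>\<^sub>2\<^sup>f (G \<box> H) = max (\<chi>\<^sub>2 G) (\<chi>\<^sub>2 H)"
    using K complete_graph_bounds_attained(2)[OF zero_less_numeral] by blast
qed

end
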